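(* There is at most one function $G$, holomorphic on $\mathbb{C}\setminus[1,\infty)$, with the following three properties: (a) for all $z\in\mathbb{C}\setminus[0,\infty)$, $$-\frac{1}{1-z}-\frac{1}{(1-z)^{2}}\,G\left(\frac{1}{1-z}\right)+2G(z+1)=G(z);$$ (b) for all $z\in\mathbb{C}\setminus[0,\infty)$, $$G(z+1)=-\frac{1}{z^{2}}\,G\left(\frac{1}{z}+1\right)-\frac{1}{z};$$ (c) $G(z)\to 0$ as $z\to\infty$ in such a way that the distance from $z$ to $\mathbb{R}_{+}=[0,\infty)$ tends to infinity. That is, if $G_1$ and $G_2$ are two such functions, then $G_1=G_2$. *)

theory Defs
  imports "HOL-Complex_Analysis.Complex_Analysis"
begin

definition real_ray :: "real \<Rightarrow> complex set" where
  "real_ray a = complex_of_real ` {a..}"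

definition eq_a :: "(complex \<Rightarrow> complex) \<Rightarrow> bool" where
  "eq_a G \<longleftrightarrow> (\<forall>z \<in> UNIV - real_ray 0.
     - (1 / (1 - z)) - (1 / (1 - z)^2) * G (1 / (1 - z)) + 2 * G (z + 1) = G z)"

definition eq_b :: "(complex \<Rightarrow> complex) \<Rightarrow> bool" where
  "eq_b G \<longleftrightarrow> (\<forall>z \<in> UNIV - real_ray 0.
     G (z + 1) = - (1 / z^2) * G (1 / z + 1) - 1 / z)"

(* The filter of neighbourhoods of infinity along which the distance to [0,\<infinity>) tends to
   infinity. Every z with positive distance to [0,\<infinity>) lies off the cut [1,\<infinity>), so values of G
   on the cut, which are irrelevant, do not enter. *)
definition vanishes_away_from_ray :: "(complex \<Rightarrow> complex) \<Rightarrow> bool" where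
  "vanishes_away_from_ray G \<longleftrightarrow>
     (G \<longlongrightarrow> 0) (inf at_infinity (filtercomap (\<lambda>z. infdist z (real_ray 0)) at_top))"

end

theory Submission imports Defs "HOL-Real_Asymp.Real_Asymp" begin

text \<open>
  Put \<open>D = G1 - G2\<close> and \<open>g t = D (1 - t)\<close> for real \<open>t > 0\<close>. At \<open>z = - t\<close> the two equations become
  \<open>2 g(t) = g(t + 1) + g(t / (t + 1)) / (1 + t)^2\<close> and \<open>g(t) = - g(1 / t) / t^2\<close>. The weight
  \<open>h(t) = 1 + 1 / t^2\<close> is a strict supersolution of the first equation, namely
  \<open>h(t + 1) + h(t / (t + 1)) / (1 + t)^2 = h(t) + 2 / (1 + t)^2 < 2 h(t)\<close>. The quotient
  \<open>|g| / h\<close> is invariant under \<open>t \<mapsto> 1 / t\<close> and tends to \<open>0\<close> at infinity, hence also at \<open>0\<close>; so it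
  attains its maximum, which must be \<open>0\<close>. The identity theorem then gives \<open>D = 0\<close>.
\<close>

text \<open>Decay makes \<open>k\<close> smaller than \<open>k t0\<close> beyond some
  \<open>T\<close>, and inversion carries this to \<open>(0, 1/T)\<close>. So only the compact
  interval \<open>[1/T, T]\<close> competes for the supremum.\<close>

lemma attains_max_of_tendsto_0_inverse_invariant:
  fixes k :: "real \<Rightarrow> real"
  assumes cont: "continuous_on {0<..} k"
    and lim: "(k \<longlongrightarrow> 0) at_top"
    and inv: "\<And>t. t > 0 \<Longrightarrow> k (1 / t) = k t"
    and t0: "t0 > 0" "k t0 > 0"
  obtains t1 where "t1 > 0" "k t1 > 0" "\<And>t. t > 0 \<Longrightarrow> k t \<le> k t1"
proof -
  have "eventually (\<lambda>t. k t < k t0) at_top"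
    using lim t0(2) by (rule order_tendstoD)
  then obtain T0 where T0: "\<And>t. t \<ge> T0 \<Longrightarrow> k t < k t0"
    by (auto simp: eventually_at_top_linorder)
  define T where "T = max 1 T0"
  have T: "T \<ge> 1" "\<And>t. t \<ge> T \<Longrightarrow> k t < k t0"
    using T0 by (auto simp: T_def)
  have small: "k t < k t0" if "t > 0" "t \<notin> {1/T..T}" for t
  proof (cases "t > T")
    case False
    then have "1 / t \<ge> T"
      using that T(1) by (simp add: field_simps)
    then show ?thesis using T(2)[of "1 / t"] inv[of t] that by simp
  qed (use T(2) in simp)
  have sub: "{1/T..T} \<subseteq> {0<..}"
  proof
    fix x assume "x \<in> {1/T..T}"
    moreover have "0 < 1 / T" using T(1) by simp
    ultimately show "x \<in> {0<..}" by (meson atLeastAtMost_iff greaterThan_iff less_le_trans)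
  qed
  have t0_in: "t0 \<in> {1/T..T}"
    using small[of t0] t0(1) by blast
  then obtain t1 where t1: "t1 \<in> {1/T..T}" "\<And>t. t \<in> {1/T..T} \<Longrightarrow> k t \<le> k t1"
    using continuous_attains_sup[of "{1/T..T}" k] continuous_on_subset[OF cont sub] by auto
  have "k t \<le> k t1" if "t > 0" for t
    using small[of t] t1(2)[of t] t1(2)[OF t0_in] that by fastforce
  then show ?thesis
    using that[of t1] t1(1) t1(2)[OF t0_in] t0(2) sub by fastforce
qed

lemma symmetric_three_term_solution_eq_0:
  fixes g :: "real \<Rightarrow> 'a::real_normed_vector"
  assumes cont: "continuous_on {0<..} g"
    and lim: "(g \<longlongrightarrow> 0) at_top"
    and three: "\<And>t. t > 0 \<Longrightarrow> 2 *\<^sub>R g t = g (t + 1) + (1 / (1 + t)^2) *\<^sub>R g (t / (1 + t))"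
    and sym: "\<And>t. t > 0 \<Longrightarrow> g t = - ((1 / t^2) *\<^sub>R g (1 / t))"
    and "t > 0"
  shows "g t = 0"
proof (rule ccontr)
  assume nz: "g t \<noteq> 0"
  \<comment> \<open>This is \<open>|g| / h\<close> with \<open>h(s) = 1 + 1 / s^2\<close>, cleared
    of the inner fraction: the factor \<open>s^2 / (1 + s^2)\<close> is continuous and at most 1, so
    \<open>k\<close> inherits continuity and decay from \<open>g\<close>.\<close>
  define k where "k s = norm (g s) * (s^2 / (1 + s^2))" for s
  have pos: "1 + s^2 > 0" for s :: real
    by (simp add: add_pos_nonneg)
  have "continuous_on {0<..} k"
    unfolding k_def using pos
    by (intro continuous_intros cont) (metis less_irrefl)
  moreover have "(k \<longlongrightarrow> 0) at_top"
  proof (rule Lim_null_comparison)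
    have "norm (k s) \<le> norm (g s)" for s
      using pos[of s] unfolding k_def by (simp add: abs_mult divide_le_eq mult_left_mono)
    then show "\<forall>\<^sub>F s in at_top. norm (k s) \<le> norm (g s)" by simp
  qed (use lim tendsto_norm_zero in blast)
  \<comment> \<open>Both \<open>|g|\<close> and \<open>h\<close> pick up the same factor under
    inversion: \<open>|g(1/s)| = s^2 |g(s)|\<close> and \<open>h(1/s) = s^2 h(s)\<close>.\<close>
  moreover have "k (1 / s) = k s" if "s > 0" for s
  proof -
    have "norm (g s) = norm (g (1 / s)) / s^2"
      using sym[OF that] by (metis norm_minus_cancel norm_scaleR abs_of_pos that
          zero_less_divide_1_iff zero_less_power mult.commute mult_1 times_divide_eq_left)
    moreover have "(1 / s)^2 / (1 + (1 / s)^2) = 1 / (1 + s^2)"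
      using that pos[of s] by (simp add: divide_simps)
    ultimately show ?thesis
      using that unfolding k_def by simp
  qed
  moreover have "k t > 0"
    using nz \<open>t > 0\<close> pos[of t] by (simp add: k_def)
  ultimately obtain x where x: "x > 0" "k x > 0" and max: "\<And>s. s > 0 \<Longrightarrow> k s \<le> k x"
    using attains_max_of_tendsto_0_inverse_invariant[of k t] \<open>t > 0\<close> by blast
  define M where "M = k x"
  have norm_g: "norm (g s) = k s * (1 + 1 / s^2)" if "s > 0" for s
  proof -
    have "s^2 * (1 + 1 / s^2) = 1 + s^2"
      using that by (simp add: distrib_left)
    then have "s^2 / (1 + s^2) * (1 + 1 / s^2) = 1"
      using pos[of s] by simp
    then show ?thesis unfolding k_def mult.assoc by (simp only: mult_1_right)
  qed
  have bound: "norm (g s) \<le> M * (1 + 1 / s^2)" if "s > 0" for s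
    using norm_g[OF that] max[OF that] by (simp add: M_def mult_right_mono)
  \<comment> \<open>At the maximum point \<open>x\<close> the estimate \<open>bound\<close> is an
    equality, so the three-term equation can be compared with the strict supersolution property of
    \<open>h\<close>.\<close>
  have "2 * (M * (1 + 1 / x^2)) = norm (2 *\<^sub>R g x)"
    using norm_g[OF x(1)] by (simp add: M_def)
  also have "\<dots> \<le> norm (g (x + 1)) + 1 / (1 + x)^2 * norm (g (x / (1 + x)))"
    using three[OF x(1)] norm_triangle_ineq by (metis abs_of_nonneg norm_scaleR zero_le_divide_1_iff zero_le_power2)
  also have "\<dots> \<le> M * (1 + 1 / (x + 1)^2) + 1 / (1 + x)^2 * (M * (1 + 1 / (x / (1 + x))^2))"
    using x(1) by (intro add_mono mult_left_mono bound) auto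
  \<comment> \<open>The last summand expands to \<open>M / (1 + x)^2 + M / x^2\<close>, since the
    square \<open>(1 + x)^2\<close> cancels in its second part.\<close>
  also have "\<dots> = M * (1 + 1 / x^2) + M * (2 * (1 / (1 + x)^2))"
    using x(1) by (simp add: power_divide distrib_left add.commute)
  finally have "M * (1 + 1 / x^2) \<le> M * (2 * (1 / (1 + x)^2))" by simp
  then have "1 + 1 / x^2 \<le> 2 * (1 / (1 + x)^2)"
    using mult_le_cancel_left_pos[OF x(2)] unfolding M_def by blast
  \<comment> \<open>Strictness comes from \<open>1 + x\<close> exceeding both \<open>1\<close> and
    \<open>x\<close>; adding the two inequalities gives the contradiction.\<close>
  moreover have "1 / (1 + x)^2 < 1" "1 / (1 + x)^2 < 1 / x^2"
    using x(1) by (auto simp: divide_simps intro!: power_strict_mono one_less_power)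
  ultimately show False by linarith
qed

lemma of_real_in_real_ray_iff: "complex_of_real x \<in> real_ray a \<longleftrightarrow> a \<le> x"
  by (auto simp: real_ray_def)

lemma open_Compl_real_ray: "open (UNIV - real_ray a)"
proof -
  have "closed (real_ray a)"
    unfolding real_ray_def
    by (intro closed_injective_linear_image) (auto intro: linearI simp: inj_on_def scaleR_conv_of_real)
  then show ?thesis by (simp add: open_Diff)
qed

text \<open>With centre 0: if \<open>u z = r\<close> lies on the ray, then
  \<open>r \<ge> a > 0\<close> forces \<open>u > 0\<close>, and \<open>z = r / u \<ge> r\<close>
  lies on the ray as well. This supplies the connectedness that the identity theorem
  requires.\<close>

lemma starlike_Compl_real_ray:
  assumes "a > 0"
  shows "starlike (UNIV - real_ray a)"
  unfolding starlike_def
proof (intro bexI ballI subsetI)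
  show "0 \<in> UNIV - real_ray a"
    using assms of_real_in_real_ray_iff[of 0 a] by simp
next
  fix z w assume z: "z \<in> UNIV - real_ray a" and "w \<in> closed_segment 0 z"
  then obtain u where u: "0 \<le> u" "u \<le> 1" "w = u *\<^sub>R z"
    by (auto simp: in_segment)
  have "w \<notin> real_ray a"
  proof
    assume "w \<in> real_ray a"
    then obtain r where r: "r \<ge> a" "w = of_real r" by (auto simp: real_ray_def)
    have "u > 0" using u r assms by (cases "u = 0") auto
    then have "z = of_real (r / u)" using u r
      by (simp add: scaleR_conv_of_real field_simps)
    moreover have "a \<le> r / u" using \<open>u > 0\<close> u(1,2) r assms
      by (simp add: le_divide_eq) (metis mult_left_le less_imp_le order_trans)
    ultimately show False using z of_real_in_real_ray_iff by blast
  qed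
  then show "w \<in> UNIV - real_ray a" by simp
qed

text \<open>Along \<open>1 - t\<close> with \<open>t\<close> tending to infinity, both the modulus
  and the distance to the ray are at least \<open>t - 1\<close>, so this path runs into the filter
  of the hypothesis.\<close>

lemma tendsto_0_minus_of_real:
  assumes "vanishes_away_from_ray G"
  shows "((\<lambda>t. G (1 - of_real t)) \<longlongrightarrow> 0) at_top"
proof -
  have norm_ge: "\<bar>1 - t\<bar> \<le> norm (1 - complex_of_real t)" for t
    by (metis norm_of_real of_real_1 of_real_diff order_refl)
  have infdist_ge: "t - 1 \<le> infdist (1 - complex_of_real t) (real_ray 0)" for t
  proof -
    have ne: "real_ray 0 \<noteq> {}" by (auto simp: real_ray_def)
    have "t - 1 \<le> dist (1 - complex_of_real t) y" if y: "y \<in> real_ray 0" for y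
    proof -
      \<comment> \<open>The real part of \<open>1 - t - r\<close> already has absolute value at
        least \<open>t - 1\<close>, because \<open>r \<ge> 0\<close>.\<close>
      obtain r where "r \<ge> 0" "y = of_real r" using y by (auto simp: real_ray_def)
      then show ?thesis
        using abs_Re_le_cmod[of "1 - complex_of_real t - y"] by (simp add: dist_norm)
    qed
    then show ?thesis
      using ne by (auto simp: infdist_notempty intro!: cINF_greatest)
  qed
  have lin: "filterlim (\<lambda>t::real. t - 1) at_top at_top" "filterlim (\<lambda>t::real. \<bar>1 - t\<bar>) at_top at_top"
    by real_asymp+
  have "filterlim (\<lambda>t. 1 - complex_of_real t)
          (inf at_infinity (filtercomap (\<lambda>z. infdist z (real_ray 0)) at_top)) at_top"
    unfolding filterlim_inf filterlim_filtercomap_iff o_def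
    using filterlim_at_top_mono[OF lin(2) always_eventually[OF allI[OF norm_ge]]]
      filterlim_at_top_mono[OF lin(1) always_eventually[OF allI[OF infdist_ge]]]
    by (auto intro: filterlim_norm_at_top_imp_at_infinity)
  then show ?thesis
    using assms filterlim_compose unfolding vanishes_away_from_ray_def by blast
qed

text \<open>Substituting \<open>z = -t\<close> works because
  \<open>1 / (1 + t) = 1 - t / (1 + t)\<close>, so every argument of \<open>G\<close> takes the form
  \<open>1 - s\<close> with \<open>s > 0\<close>. The inhomogeneous term is independent of
  \<open>G\<close> and cancels in a difference of two solutions.\<close>

lemma eq_a_minus_of_real:
  assumes "eq_a G" "t > 0"
  shows "2 * G (1 - of_real t)
    = G (1 - of_real (t + 1)) + (1 / (1 + t)^2) *\<^sub>R G (1 - of_real (t / (1 + t))) + 1 / (1 + of_real t)"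
proof -
  have "complex_of_real (-t) \<in> UNIV - real_ray 0"
    using assms(2) of_real_in_real_ray_iff[of "-t" 0] by simp
  moreover have arg: "1 - complex_of_real (t / (1 + t)) = 1 / (1 - of_real (-t))"
  proof -
    have "1 - t / (1 + t) = 1 / (1 - (-t))" using assms(2) by (simp add: field_simps)
    then show ?thesis by (metis of_real_1 of_real_diff of_real_divide)
  qed
  ultimately show ?thesis
    using bspec[OF assms(1)[unfolded eq_a_def], of "complex_of_real (-t)"]
    unfolding arg by (simp add: scaleR_conv_of_real algebra_simps)
qed

lemma eq_b_minus_of_real:
  assumes "eq_b G" "t > 0"
  shows "G (1 - of_real t) = - ((1 / t^2) *\<^sub>R G (1 - of_real (1 / t))) + 1 / of_real t"
proof -
  have "complex_of_real (-t) \<in> UNIV - real_ray 0"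
    using assms(2) of_real_in_real_ray_iff[of "-t" 0] by simp
  then show ?thesis
    using assms unfolding eq_b_def
    by (auto simp: scaleR_conv_of_real dest!: bspec[of _ _ "complex_of_real (-t)"])
qed

theorem proposition4:
  fixes G1 G2 :: "complex \<Rightarrow> complex"
  assumes "G1 holomorphic_on (UNIV - real_ray 1)" and "G2 holomorphic_on (UNIV - real_ray 1)"
    and "eq_a G1" and "eq_a G2"
    and "eq_b G1" and "eq_b G2"
    and "vanishes_away_from_ray G1" and "vanishes_away_from_ray G2"
  shows "\<forall>z \<in> UNIV - real_ray 1. G1 z = G2 z"
proof
  fix z assume z: "z \<in> UNIV - real_ray 1"
  define D where "D w = G1 w - G2 w" for w
  define g where "g t = D (1 - of_real t)" for t :: real
  have hol: "D holomorphic_on (UNIV - real_ray 1)"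
    unfolding D_def using assms by (intro holomorphic_intros)
  have g0: "g t = 0" if "t > 0" for t
  proof (rule symmetric_three_term_solution_eq_0[OF _ _ _ _ that])
    show "continuous_on {0<..} g"
      unfolding g_def
    proof (rule continuous_on_compose2[OF holomorphic_on_imp_continuous_on[OF hol]])
      have "complex_of_real (1 - t) \<notin> real_ray 1" if "t > 0" for t
        using that by (subst of_real_in_real_ray_iff) simp
      then show "(\<lambda>t. 1 - complex_of_real t) ` {0<..} \<subseteq> UNIV - real_ray 1" by auto
    qed (intro continuous_intros)
    show "(g \<longlongrightarrow> 0) at_top"
      using tendsto_diff[OF tendsto_0_minus_of_real[OF assms(7)] tendsto_0_minus_of_real[OF assms(8)]]
      unfolding g_def D_def by simp
    show "2 *\<^sub>R g s = g (s + 1) + (1 / (1 + s)^2) *\<^sub>R g (s / (1 + s))" if "s > 0" for s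
      using eq_a_minus_of_real[OF assms(3) that] eq_a_minus_of_real[OF assms(4) that]
      unfolding g_def D_def scaleR_2 scaleR_diff_right by (simp add: algebra_simps)
    show "g s = - ((1 / s^2) *\<^sub>R g (1 / s))" if "s > 0" for s
      using eq_b_minus_of_real[OF assms(5) that] eq_b_minus_of_real[OF assms(6) that]
      unfolding g_def D_def scaleR_diff_right by simp
  qed
  have "D z = 0"
  proof (rule analytic_continuation[OF hol open_Compl_real_ray])
    show "connected (UNIV - real_ray 1)"
      using starlike_imp_connected[OF starlike_Compl_real_ray[of 1]] by simp
    show "complex_of_real ` {..<1} \<subseteq> UNIV - real_ray 1"
      by (auto simp: of_real_in_real_ray_iff)
    show "0 \<in> UNIV - real_ray 1"
      using of_real_in_real_ray_iff[of 0 1] by simp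
    \<comment> \<open>The zeros of \<open>D\<close> found so far fill the real half-line below 1.
      That 0 is a limit point of it is clear in the reals and is carried to the complex plane along
      a sequence.\<close>
    have "0 islimpt {..<1::real}"
      by (rule interior_limit_point) (simp add: interior_open)
    then show "0 islimpt complex_of_real ` {..<1}"
      unfolding islimpt_sequential
    proof (elim exE conjE)
      fix f :: "nat \<Rightarrow> real" assume f: "\<forall>n. f n \<in> {..<1} - {0}" "f \<longlonglongrightarrow> 0"
      then have "(\<lambda>n. complex_of_real (f n)) \<longlonglongrightarrow> 0"
        by (metis of_real_0 tendsto_of_real)
      then show "\<exists>h. (\<forall>n. h n \<in> complex_of_real ` {..<1} - {0}) \<and> h \<longlonglongrightarrow> 0"
        using f(1) by (intro exI[of _ "\<lambda>n. complex_of_real (f n)"]) auto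
    qed
    show "D w = 0" if "w \<in> complex_of_real ` {..<1}" for w
    proof -
      obtain r where "r < 1" "w = of_real r" using \<open>w \<in> _\<close> by auto
      then show ?thesis using g0[of "1 - r"] by (simp add: g_def)
    qed
  qed (use z in auto)
  then show "G1 z = G2 z" by (simp add: D_def)
qed

end
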